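(* Let $K$ and $Y$ be heaps with $K$ non-empty. Let $\alpha\colon Y\to \mathrm{Aut}(K)$, $b\mapsto\alpha_b$, be a heap morphism into the heap of heap automorphisms of $K$, and let $y\in Y$ be an element such that $\alpha_y$ is the identity automorphism of $K$. On the cartesian product $K\times Y$ define a ternary operation by $$[(k_1,y_1),(k_2,y_2),(k_3,y_3)]:=\bigl([k_1,\alpha_{[y_1,y_2,y]}(k_2),\alpha_{[y_1,y_2,y]}(k_3)],\,[y_1,y_2,y_3]\bigr)$$ for all $(k_1,y_1),(k_2,y_2),(k_3,y_3)\in K\times Y$. Then: (a) $K\times Y$ is a heap and $K\times\{y\}$ is a normal subheap of $K\times Y$ isomorphic to $K$. (b) For every $k\in K$, $\{k\}\times Y$ is a subheap of $K\times Y$ isomorphic to $Y$, and the mapping $f\colon K\times Y\to K\times Y$ defined by $f(a,b)=(k,b)$ for every $(a,b)\in K\times Y$ is an idempotent heap endomorphism of $K\times Y$.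
   Context: A heap is a set $X$ with a ternary operation $[x,y,z]$ such that $[[x,y,z],w,u]=[x,y,[z,w,u]]$, $[x,x,y]=y$ and $[x,y,y]=x$ for all $x,y,z,w,u\in X$. Heap morphisms are the maps preserving the ternary operation; a subheap is a subset closed under it. A normal subheap of $X$ is a non-empty subheap $S$ such that $[[x,e,s],x,e]\in S$ for every $x\in X$ and all $e,s\in S$. $\mathrm{Aut}(K)$ denotes the set of all heap automorphisms of $K$, regarded as a heap with $[f,g,h]=f\circ g^{-1}\circ h$. *)

theory Defs
  imports "HOL-Algebra.Congruence" "HOL-Library.FuncSet"
begin

record 'a heap_struct = "'a partial_object" +
  heap_op :: "['a, 'a, 'a] \<Rightarrow> 'a" ("(\<langle>_,/ _,/ _\<rangle>\<index>)")

text \<open>The carrier may be empty.\<close>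

locale heap =
  fixes H (structure)
  assumes op_closed:
      "\<lbrakk>x \<in> carrier H; y \<in> carrier H; z \<in> carrier H\<rbrakk> \<Longrightarrow> \<langle>x, y, z\<rangle> \<in> carrier H"
    and op_assoc:
      "\<lbrakk>x \<in> carrier H; y \<in> carrier H; z \<in> carrier H; w \<in> carrier H; u \<in> carrier H\<rbrakk>
        \<Longrightarrow> \<langle>\<langle>x, y, z\<rangle>, w, u\<rangle> = \<langle>x, y, \<langle>z, w, u\<rangle>\<rangle>"
    and op_left: "\<lbrakk>x \<in> carrier H; y \<in> carrier H\<rbrakk> \<Longrightarrow> \<langle>x, x, y\<rangle> = y"
    and op_right: "\<lbrakk>x \<in> carrier H; y \<in> carrier H\<rbrakk> \<Longrightarrow> \<langle>x, y, y\<rangle> = x"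

definition heap_hom :: "('a, 'm) heap_struct_scheme \<Rightarrow> ('b, 'n) heap_struct_scheme \<Rightarrow> ('a \<Rightarrow> 'b) set"
  where "heap_hom G H = {f \<in> carrier G \<rightarrow> carrier H.
    \<forall>x\<in>carrier G. \<forall>y\<in>carrier G. \<forall>z\<in>carrier G.
      f \<langle>x, y, z\<rangle>\<^bsub>G\<^esub> = \<langle>f x, f y, f z\<rangle>\<^bsub>H\<^esub>}"

definition heap_iso :: "('a, 'm) heap_struct_scheme \<Rightarrow> ('b, 'n) heap_struct_scheme \<Rightarrow> ('a \<Rightarrow> 'b) set"
  where "heap_iso G H = {f \<in> heap_hom G H. bij_betw f (carrier G) (carrier H)}"

definition heap_isomorphic :: "('a, 'm) heap_struct_scheme \<Rightarrow> ('b, 'n) heap_struct_scheme \<Rightarrow> bool"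
  where "heap_isomorphic G H \<longleftrightarrow> heap_iso G H \<noteq> {}"

definition subheap :: "'a set \<Rightarrow> ('a, 'm) heap_struct_scheme \<Rightarrow> bool"
  where "subheap S H \<longleftrightarrow> S \<subseteq> carrier H \<and>
    (\<forall>x\<in>S. \<forall>y\<in>S. \<forall>z\<in>S. \<langle>x, y, z\<rangle>\<^bsub>H\<^esub> \<in> S)"

definition normal_subheap :: "'a set \<Rightarrow> ('a, 'm) heap_struct_scheme \<Rightarrow> bool"
  where "normal_subheap S H \<longleftrightarrow> subheap S H \<and> S \<noteq> {} \<and>
    (\<forall>x\<in>carrier H. \<forall>e\<in>S. \<forall>s\<in>S. \<langle>\<langle>x, e, s\<rangle>\<^bsub>H\<^esub>, x, e\<rangle>\<^bsub>H\<^esub> \<in> S)"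

text \<open>
  Automorphisms are required to be extensional, so that two elements of the carrier are equal
  precisely when they agree on the carrier of the underlying heap. The operation is
  \<open>f \<circ> g\<inverse> \<circ> h\<close>, restricted accordingly.
\<close>

definition heap_Aut :: "('a, 'm) heap_struct_scheme \<Rightarrow> ('a \<Rightarrow> 'a) heap_struct"
  where "heap_Aut H = \<lparr>
    carrier = heap_iso H H \<inter> extensional (carrier H),
    heap_op = (\<lambda>f g h. compose (carrier H) f
      (compose (carrier H) (inv_into (carrier H) g) h)) \<rparr>"

definition semidirect_heap ::
    "('k, 'm) heap_struct_scheme \<Rightarrow> ('y, 'n) heap_struct_scheme \<Rightarrow> ('y \<Rightarrow> 'k \<Rightarrow> 'k) \<Rightarrow> 'y
      \<Rightarrow> ('k \<times> 'y) heap_struct"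
  where "semidirect_heap K Y \<alpha> y = \<lparr>
    carrier = carrier K \<times> carrier Y,
    heap_op = (\<lambda>(k1, y1) (k2, y2) (k3, y3).
      (\<langle>k1, \<alpha> \<langle>y1, y2, y\<rangle>\<^bsub>Y\<^esub> k2, \<alpha> \<langle>y1, y2, y\<rangle>\<^bsub>Y\<^esub> k3\<rangle>\<^bsub>K\<^esub>, \<langle>y1, y2, y3\<rangle>\<^bsub>Y\<^esub>)) \<rparr>"

end

theory Submission
  imports Defs
begin

text \<open>
  Write \<open>A = \<alpha>\<^bsub>[y\<^sub>1,y\<^sub>2,y]\<^esub>\<close> and \<open>C = \<alpha>\<^bsub>[y\<^sub>3,y\<^sub>4,y]\<^esub>\<close>. Since \<open>\<alpha>\<^bsub>y\<^esub>\<close> is the identity and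
  \<open>[[y\<^sub>1,y\<^sub>2,y\<^sub>3],y\<^sub>4,y] = [[y\<^sub>1,y\<^sub>2,y],y,[y\<^sub>3,y\<^sub>4,y]]\<close>, the automorphism attached to
  \<open>[y\<^sub>1,y\<^sub>2,y\<^sub>3]\<close> and \<open>y\<^sub>4\<close> is \<open>A \<circ> C\<close>; associativity of the product then follows from the
  associativity of \<open>K\<close> and from \<open>A\<close> being a heap morphism.
\<close>

lemma heap_homD:
  assumes "f \<in> heap_hom G H"
  shows "x \<in> carrier G \<Longrightarrow> f x \<in> carrier H"
    and "\<lbrakk>x \<in> carrier G; y \<in> carrier G; z \<in> carrier G\<rbrakk> \<Longrightarrow>
      f (heap_op G x y z) = heap_op H (f x) (f y) (f z)"
  using assms by (auto simp: heap_hom_def)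

lemma heap_Aut_hom: "f \<in> carrier (heap_Aut H) \<Longrightarrow> f \<in> heap_hom H H"
  by (simp add: heap_Aut_def heap_iso_def)

text \<open>The inverse of the identity fixes \<open>h x\<close>, which lies in the carrier, so
  \<open>f \<circ> g\<inverse> \<circ> h\<close> collapses to plain composition at
  \<open>x\<close>.\<close>

lemma heap_Aut_op_id:
  assumes "f \<in> carrier (heap_Aut H)" "h \<in> carrier (heap_Aut H)" "x \<in> carrier H"
  shows "heap_op (heap_Aut H) f (\<lambda>k\<in>carrier H. k) h x = f (h x)"
proof -
  have hx: "h x \<in> carrier H"
    by (rule heap_homD(1)[OF heap_Aut_hom[OF assms(2)] assms(3)])
  have "inj_on (\<lambda>k\<in>carrier H. k) (carrier H)"
    by (simp add: inj_on_def)
  from inv_into_f_f[OF this hx] hx have "inv_into (carrier H) (\<lambda>k\<in>carrier H. k) (h x) = h x"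
    by simp
  with assms hx show ?thesis
    by (simp add: heap_Aut_def compose_def)
qed

lemma carrier_semidirect_heap [simp]:
  "carrier (semidirect_heap K Y \<alpha> y) = carrier K \<times> carrier Y"
  by (simp add: semidirect_heap_def)

lemma op_semidirect_heap [simp]:
  "heap_op (semidirect_heap K Y \<alpha> y) (k1, y1) (k2, y2) (k3, y3) =
    (heap_op K k1 (\<alpha> (heap_op Y y1 y2 y) k2) (\<alpha> (heap_op Y y1 y2 y) k3), heap_op Y y1 y2 y3)"
  by (simp add: semidirect_heap_def)

locale pointed_heap_action = K: heap K + Y: heap Y
  for K :: "('k, 'm) heap_struct_scheme" and Y :: "('y, 'n) heap_struct_scheme" +
  fixes \<alpha> :: "'y \<Rightarrow> 'k \<Rightarrow> 'k" and y :: 'y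
  assumes action_hom: "\<alpha> \<in> heap_hom Y (heap_Aut K)"
    and base_closed: "y \<in> carrier Y"
    and action_base: "\<alpha> y = (\<lambda>k\<in>carrier K. k)"
begin

abbreviation P where "P \<equiv> semidirect_heap K Y \<alpha> y"

lemma action_Aut: "b \<in> carrier Y \<Longrightarrow> \<alpha> b \<in> carrier (heap_Aut K)"
  using action_hom by (rule heap_homD)

lemma action_closed: "\<lbrakk>b \<in> carrier Y; k \<in> carrier K\<rbrakk> \<Longrightarrow> \<alpha> b k \<in> carrier K"
  by (rule heap_homD(1)[OF heap_Aut_hom[OF action_Aut]])

lemma action_op:
  "\<lbrakk>b \<in> carrier Y; k \<in> carrier K; l \<in> carrier K; m \<in> carrier K\<rbrakk> \<Longrightarrow>
    \<alpha> b (heap_op K k l m) = heap_op K (\<alpha> b k) (\<alpha> b l) (\<alpha> b m)"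
  by (rule heap_homD(2)[OF heap_Aut_hom[OF action_Aut]])

text \<open>In \<alpha>[b,y,c] = [\<alpha> b, \<alpha> y, \<alpha> c] the middle entry is the
  identity. Thus \<alpha> acts like a group homomorphism once \<open>y\<close> is taken as the unit
  of \<open>Y\<close>.\<close>

lemma action_comp:
  assumes "b \<in> carrier Y" "c \<in> carrier Y" "k \<in> carrier K"
  shows "\<alpha> (heap_op Y b y c) k = \<alpha> b (\<alpha> c k)"
  using heap_homD(2)[OF action_hom assms(1) base_closed assms(2)] assms
  by (simp add: action_base heap_Aut_op_id action_Aut)

text \<open>The nesting [a,b,[c,d,y]] is what \<open>Y.op_assoc\<close> rewrites [[a,b,c],d,y] to,
  so this equation fires as a rewrite rule in the associativity proof.\<close>

lemma action_comp_differences: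
  assumes "a \<in> carrier Y" "b \<in> carrier Y" "c \<in> carrier Y" "d \<in> carrier Y" "k \<in> carrier K"
  shows "\<alpha> (heap_op Y a b (heap_op Y c d y)) k =
    \<alpha> (heap_op Y a b y) (\<alpha> (heap_op Y c d y) k)"
proof -
  \<comment> \<open>The base point is inserted through [y,y,z] = z for z = [c,d,y].\<close>
  have "heap_op Y a b (heap_op Y c d y) = heap_op Y (heap_op Y a b y) y (heap_op Y c d y)"
    using assms base_closed by (simp add: Y.op_assoc Y.op_left Y.op_closed)
  then show ?thesis
    using assms base_closed by (simp add: action_comp Y.op_closed)
qed

lemma heap_semidirect: "heap P"
proof
  fix p1 p2 p3 assume "p1 \<in> carrier P" "p2 \<in> carrier P" "p3 \<in> carrier P"
  then show "heap_op P p1 p2 p3 \<in> carrier P"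
    using base_closed by (auto simp: K.op_closed Y.op_closed action_closed)
next
  fix p1 p2 p3 p4 p5
  assume "p1 \<in> carrier P" "p2 \<in> carrier P" "p3 \<in> carrier P" "p4 \<in> carrier P" "p5 \<in> carrier P"
  then show "heap_op P (heap_op P p1 p2 p3) p4 p5 = heap_op P p1 p2 (heap_op P p3 p4 p5)"
    using base_closed
    by (auto simp: K.op_closed Y.op_closed action_closed action_comp_differences
        action_op K.op_assoc Y.op_assoc)
next
  fix p1 p2 assume "p1 \<in> carrier P" "p2 \<in> carrier P"
  \<comment> \<open>Here the twist is at [b,b,y] = y, hence trivial.\<close>
  then show "heap_op P p1 p1 p2 = p2"
    using base_closed by (auto simp: Y.op_left K.op_left action_base)
next
  fix p1 p2 assume "p1 \<in> carrier P" "p2 \<in> carrier P"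
  \<comment> \<open>No property of the twist matters beyond closure: its two values coincide and
    cancel in \<open>K\<close>.\<close>
  then show "heap_op P p1 p2 p2 = p1"
    using base_closed by (auto simp: Y.op_right Y.op_closed K.op_right action_closed)
qed

text \<open>For x over b and e, s over \<open>y\<close>, the element [[x,e,s],x,e] lies over
  [[b,y,y],b,y] = [b,b,y] = y.\<close>

lemma normal_subheap_fibre:
  assumes "carrier K \<noteq> {}"
  shows "normal_subheap (carrier K \<times> {y}) P"
  using assms base_closed
  by (auto simp: normal_subheap_def subheap_def K.op_closed Y.op_closed Y.op_left Y.op_right
      action_closed)

text \<open>Over \<open>y\<close> every twist is at [y,y,y] = y, so first coordinates multiply as in
  \<open>K\<close> and \<open>fst\<close> is an isomorphism.\<close>

lemma fibre_isomorphic: "heap_isomorphic (P\<lparr>carrier := carrier K \<times> {y}\<rparr>) K"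
proof -
  have "fst \<in> heap_iso (P\<lparr>carrier := carrier K \<times> {y}\<rparr>) K"
    using base_closed
    by (auto simp: heap_iso_def heap_hom_def bij_betw_def inj_on_def Y.op_left action_base)
  then show ?thesis
    by (auto simp: heap_isomorphic_def)
qed

text \<open>Equal first coordinates persist because [k, A k, A k] = k for every twist A.\<close>

lemma subheap_section: "k \<in> carrier K \<Longrightarrow> subheap ({k} \<times> carrier Y) P"
  using base_closed
  by (auto simp: subheap_def K.op_right Y.op_closed action_closed)

lemma section_isomorphic:
  assumes "k \<in> carrier K"
  shows "heap_isomorphic (P\<lparr>carrier := {k} \<times> carrier Y\<rparr>) Y"
proof -
  have "snd \<in> heap_iso (P\<lparr>carrier := {k} \<times> carrier Y\<rparr>) Y"
    using assms by (auto simp: heap_iso_def heap_hom_def bij_betw_def inj_on_def)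
  then show ?thesis
    by (auto simp: heap_isomorphic_def)
qed

text \<open>The operation on second coordinates ignores the first ones, and the constant first
  coordinate survives by the same cancellation as in \<open>subheap_section\<close>.\<close>

lemma projection_hom: "k \<in> carrier K \<Longrightarrow> (\<lambda>(a, b). (k, b)) \<in> heap_hom P P"
  using base_closed
  by (auto simp: heap_hom_def K.op_right Y.op_closed action_closed)

end

theorem proposition5p4:
  fixes K :: "('k, 'm) heap_struct_scheme"
    and Y :: "('y, 'n) heap_struct_scheme"
    and \<alpha> :: "'y \<Rightarrow> 'k \<Rightarrow> 'k"
    and y :: 'y
  assumes "heap K" and "heap Y"
    and "carrier K \<noteq> {}"
    and "\<alpha> \<in> heap_hom Y (heap_Aut K)"
    and "y \<in> carrier Y"
    and "\<alpha> y = (\<lambda>k\<in>carrier K. k)"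
  defines "P \<equiv> semidirect_heap K Y \<alpha> y"
  shows "(heap P
      \<and> normal_subheap (carrier K \<times> {y}) P
      \<and> heap_isomorphic (P\<lparr>carrier := carrier K \<times> {y}\<rparr>) K)
    \<and> (\<forall>k\<in>carrier K.
        subheap ({k} \<times> carrier Y) P
      \<and> heap_isomorphic (P\<lparr>carrier := {k} \<times> carrier Y\<rparr>) Y
      \<and> (\<lambda>(a, b). (k, b)) \<in> heap_hom P P
      \<and> (\<forall>p\<in>carrier P. (\<lambda>(a, b). (k, b)) ((\<lambda>(a, b). (k, b)) p) = (\<lambda>(a, b). (k, b)) p))"
proof -
  interpret pointed_heap_action K Y \<alpha> y
    using assms by (simp add: pointed_heap_action_def pointed_heap_action_axioms_def)
  show ?thesis
    unfolding P_def
    using heap_semidirect normal_subheap_fibre[OF assms(3)] fibre_isomorphic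
      subheap_section section_isomorphic projection_hom
    by auto
qed

end
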